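(* Let $a, b, c$ be nonzero integers such that $-ab$ is not a perfect square and $\gcd(a,b,c)=1$, and let $X, Y \in M_2(\mathbb{Z})$. Then $aX^2 + bY^2 = cI$ and $XY = YX$ if and only if one of the following holds: (i) $X = t_1 I$ and $Y = t_2 I$, where $t_1, t_2 \in \mathbb{Z}$ satisfy $a t_1^2 + b t_2^2 = c$; (ii) $X = t_1 I$ and $Y = \begin{pmatrix} t_4 & t_2 \\ t_3 & -t_4 \end{pmatrix}$, where $t_1, t_2, t_3, t_4 \in \mathbb{Z}$ satisfy $a t_1^2 + b(t_4^2 + t_2 t_3) = c$; (iii) $X = t_1 I + \frac{u-c}{g}\begin{pmatrix} 0 & t_2 \\ t_3 & -k \end{pmatrix}$ and $Y = t_4 I + \frac{va}{g}\begin{pmatrix} 0 & t_2 \\ t_3 & -k \end{pmatrix}$, where $t_1, t_2, t_3, t_4, u, v, k \in \mathbb{Z}$, $u \neq c$, $g = \gcd(va, u-c)$, and $$u^2 + v^2 ab = c^2, \qquad a t_1^2 + b t_4^2 + \frac{2ac\, t_2 t_3}{g^2}(c-u) = c, \qquad (g t_1 + ck)(u-c) + vbg\, t_4 = 0.$$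
   Context: $M_2(\mathbb{Z})$ denotes the ring of $2\times 2$ matrices with integer entries; $I$ is the $2\times 2$ identity matrix. *)

theory Defs
  imports
    Complex_Main
    "HOL-Computational_Algebra.Nth_Powers"
    "Jordan_Normal_Form.Matrix"
begin

text \<open>
  Elements of $M_2(\mathbb{Z})$ are integer matrices in \<open>carrier_mat 2 2\<close>.  The quotients of
  \<open>u - c\<close> and \<open>v * a\<close> by \<open>g = gcd (v * a) (u - c)\<close> are exact (and \<open>g > 0\<close> as \<open>u \<noteq> c\<close>),
  so integer \<open>div\<close> does not truncate there.  The quotient by \<open>g\<^sup>2\<close> need not be an integer, so the
  equation containing it is read over the rationals.
\<close>

end

theory Submission
  imports Defs
begin

text \<open>
  Commuting integer matrices \<open>X\<close> and \<open>Y\<close> have parallel trace-free parts, so if \<open>X\<close> is not scalar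
  then \<open>X = s I + p N\<close> and \<open>Y = t I + q N\<close> with \<open>p\<close>, \<open>q\<close> coprime and \<open>N\<close> an integer matrix with
  upper left entry \<open>0\<close>, characteristic polynomial \<open>z\<^sup>2 + k z - m\<close>.  Put \<open>D = a p\<^sup>2 + b q\<^sup>2\<close>, which is
  nonzero because \<open>- a b\<close> is not a square.  By Cayley-Hamilton the matrix equation says
  \<open>a s\<^sup>2 + b t\<^sup>2 + D m = c\<close> and \<open>2 (a p s + b q t) = k D\<close>.  The conditions \<open>u - c = p g\<close>,
  \<open>v a = q g\<close>, \<open>u\<^sup>2 + v\<^sup>2 a b = c\<^sup>2\<close> force \<open>g = - 2 a c p / D\<close> and \<open>v = - 2 c p q / D\<close>, and the two
  equations imply that these quotients are integers.
\<close>

section \<open>Entrywise arithmetic of 2 x 2 matrices\<close>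

text \<open>Abbreviates the matrix literal of the theorem, so that simp rules for it reduce matrix
  identities to scalar ones.\<close>

definition mat22 :: "'a \<Rightarrow> 'a \<Rightarrow> 'a \<Rightarrow> 'a \<Rightarrow> 'a mat" where
  "mat22 x y z w = mat_of_rows_list 2 [[x, y], [z, w]]"

lemma mat22_carrier [simp]: "mat22 x y z w \<in> carrier_mat 2 2"
  by (simp add: mat22_def mat_of_rows_list_def numeral_2_eq_2)

lemma mat22_index [simp]:
  "mat22 x y z w $$ (0, 0) = x" "mat22 x y z w $$ (0, Suc 0) = y"
  "mat22 x y z w $$ (Suc 0, 0) = z" "mat22 x y z w $$ (Suc 0, Suc 0) = w"
  by (simp_all add: mat22_def mat_of_rows_list_def)

lemma mat22_dim [simp]: "dim_row (mat22 x y z w) = 2" "dim_col (mat22 x y z w) = 2"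
  by (simp_all add: mat22_def mat_of_rows_list_def)

lemma eq_mat22_iff:
  assumes "A \<in> carrier_mat 2 2"
  shows "A = mat22 x y z w \<longleftrightarrow>
    A $$ (0, 0) = x \<and> A $$ (0, 1) = y \<and> A $$ (1, 0) = z \<and> A $$ (1, 1) = w"
  using assms by (auto intro!: eq_matI simp: less_2_cases_iff)

lemma mat22_eq_iff [simp]:
  "mat22 x y z w = mat22 x' y' z' w' \<longleftrightarrow> x = x' \<and> y = y' \<and> z = z' \<and> w = w'"
  by (simp add: eq_mat22_iff)

lemma mat22_add [simp]:
  "mat22 x y z w + mat22 x' y' z' w' = mat22 (x + x') (y + y') (z + z') (w + w')"
  by (subst eq_mat22_iff) auto

lemma mat22_smult [simp]: "r \<cdot>\<^sub>m mat22 x y z w = mat22 (r * x) (r * y) (r * z) (r * w)"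
  by (subst eq_mat22_iff) auto

lemma mat22_mult [simp]:
  fixes x y z w :: "'a :: comm_semiring_0"
  shows "mat22 x y z w * mat22 x' y' z' w' =
    mat22 (x * x' + y * z') (x * y' + y * w') (z * x' + w * z') (z * y' + w * w')"
  by (subst eq_mat22_iff) (auto simp: scalar_prod_def numeral_2_eq_2)

lemma one_mat22: "1\<^sub>m 2 = mat22 1 0 0 1"
  by (subst eq_mat22_iff) auto

lemma mat22_pow2 [simp]:
  fixes x y z w :: "'a :: comm_semiring_1"
  shows "mat22 x y z w ^\<^sub>m 2 =
    mat22 (x * x + y * z) (x * y + y * w) (z * x + w * z) (z * y + w * w)"
proof -
  have "A ^\<^sub>m 2 = A * A" if "A \<in> carrier_mat 2 2" for A :: "'a mat"
    using that by (simp add: numeral_2_eq_2)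
  then show ?thesis by simp
qed

lemma mat22_cases:
  assumes "A \<in> carrier_mat 2 2"
  obtains x y z w where "A = mat22 x y z w"
  using eq_mat22_iff[OF assms] by blast

text \<open>The equations are the vanishing 2 x 2 minors of the coordinate vectors
  \<open>(y, z, w - x)\<close> and \<open>(y', z', w' - x')\<close> of the trace-free parts.\<close>

lemma mat22_commute_iff:
  fixes x y z w :: int
  shows "mat22 x y z w * mat22 x' y' z' w' = mat22 x' y' z' w' * mat22 x y z w \<longleftrightarrow>
    y * z' = z * y' \<and> y * (w' - x') = (w - x) * y' \<and> z * (w' - x') = (w - x) * z'"
  by (auto simp: algebra_simps)

section \<open>Parallel integer vectors and the form
  \<open>a * p\<^sup>2 + b * q\<^sup>2\<close>\<close>

text \<open>One pair with \<open>f i\<^sub>0\<close> nonzero, divided by its gcd, gives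
  \<open>p\<close> and \<open>q\<close>. Then \<open>p * h i = f i * q\<close>, and coprimality
  makes \<open>p\<close> divide every \<open>f i\<close>.\<close>

lemma parallel_int_families:
  fixes f h :: "'i \<Rightarrow> int"
  assumes par: "\<And>i j. f i * h j = f j * h i" and "f i\<^sub>0 \<noteq> 0"
  obtains p q w where "coprime p q" "p \<noteq> 0" "\<And>i. f i = p * w i" "\<And>i. h i = q * w i"
proof -
  define d where "d = gcd (f i\<^sub>0) (h i\<^sub>0)"
  define p where "p = f i\<^sub>0 div d"
  define q where "q = h i\<^sub>0 div d"
  have d: "d \<noteq> 0" "f i\<^sub>0 = d * p" "h i\<^sub>0 = d * q"
    using assms(2) by (auto simp: d_def p_def q_def)
  have cop: "coprime p q"
    using assms(2) unfolding p_def q_def d_def by (intro div_gcd_coprime) auto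
  have p0: "p \<noteq> 0" using d assms(2) by auto
  have cross: "p * h i = f i * q" for i
    using par[of i\<^sub>0 i] d by (simp add: algebra_simps)
  have "p dvd f i" for i
    using cross[of i] cop by (metis coprime_dvd_mult_left_iff dvd_triv_left)
  then have f: "f i = p * (f i div p)" for i by simp
  have "p * h i = p * (q * (f i div p))" for i
    by (subst cross) (metis f mult.assoc mult.commute)
  then have "h i = q * (f i div p)" for i using p0 by simp
  with that[OF cop p0, of "\<lambda>i. f i div p"] f show thesis by blast
qed

text \<open>A zero would make \<open>- a * b\<close> the square of the quotient of
  \<open>b * q\<close> by \<open>p\<close>, which is an integer because \<open>p\<^sup>2\<close>
  divides \<open>(b * q)\<^sup>2\<close>.\<close>

lemma binary_form_nonzero:
  fixes a b p q :: int
  assumes "\<not> is_square (- a * b)" and "p \<noteq> 0"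
  shows "a * p\<^sup>2 + b * q\<^sup>2 \<noteq> 0"
proof
  assume *: "a * p\<^sup>2 + b * q\<^sup>2 = 0"
  have eq: "(b * q)\<^sup>2 = p\<^sup>2 * (- a * b)"
    using arg_cong[OF *, of "\<lambda>x. b * x"] by (simp add: power2_eq_square algebra_simps)
  then have "p\<^sup>2 dvd (b * q)\<^sup>2" by (metis dvd_triv_left)
  then have "p dvd b * q" by simp
  then obtain r where "b * q = p * r" by blast
  with eq have "p\<^sup>2 * r\<^sup>2 = p\<^sup>2 * (- a * b)" by (simp add: power_mult_distrib)
  with \<open>p \<noteq> 0\<close> have "- a * b = r\<^sup>2" by (simp only: mult_cancel_left) simp
  with assms(1) show False by (metis is_nth_powerI)
qed

text \<open>Both divisibilities reduce modulo \<open>D\<close> to multiples of \<open>e = p t - q s\<close>, and \<open>D\<close> divides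
  \<open>2 a p e\<close> and \<open>2 b q e\<close>.\<close>

lemma form_value_divides:
  fixes a b c p q s t k m :: int
  defines "D \<equiv> a * p\<^sup>2 + b * q\<^sup>2"
  assumes cop: "coprime p q"
    and norm: "a * s\<^sup>2 + b * t\<^sup>2 + D * m = c"
    and lin: "2 * (a * p * s + b * q * t) = k * D"
  shows "D dvd 2 * a * c * p" and "D dvd 2 * c * p * q"
proof -
  define e where "e = p * t - q * s"
  have "2 * a * p * e = D * (2 * t) - q * (2 * (a * p * s + b * q * t))"
    unfolding e_def D_def by (simp add: algebra_simps power2_eq_square)
  then have E1: "D dvd 2 * a * p * e" using lin by simp
  have "2 * b * q * e = p * (2 * (a * p * s + b * q * t)) - D * (2 * s)"
    unfolding e_def D_def by (simp add: algebra_simps power2_eq_square)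
  then have E2: "D dvd 2 * b * q * e" using lin by simp
  \<comment> \<open>The Bezout combination removes the factors \<open>p\<close> and \<open>q\<close>
    from the two divisibilities.\<close>
  obtain x y where xy: "x * p + y * q = 1"
    using cop by (metis bezout_int coprime_imp_gcd_eq_1)
  have "2 * a * b * e = b * x * (2 * a * p * e) + a * y * (2 * b * q * e)"
    using xy by Groebner_Basis.algebra
  then have E3: "D dvd 2 * a * b * e" using E1 E2 by simp
  have "2 * a * c * p = D * (2 * a * m * p) + a * s * (2 * (a * p * s + b * q * t))
      + t * (2 * a * b * e)"
    unfolding e_def norm[symmetric] by (simp add: algebra_simps power2_eq_square)
  then show "D dvd 2 * a * c * p" using E3 lin by simp
  have "2 * c * p * q = D * (2 * m * p * q) + s * q * (2 * (a * p * s + b * q * t))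
      + t * (2 * b * q * e)"
    unfolding e_def norm[symmetric] by (simp add: algebra_simps power2_eq_square)
  then show "D dvd 2 * c * p * q" using E2 lin by simp
qed

section \<open>Scalar forms of the matrix equation and of the conditions in (iii)\<close>

text \<open>Since \<open>N\<close> squared is \<open>y * z\<close> times the identity minus
  \<open>k\<close> times \<open>N\<close>, the left side is a scalar matrix plus \<open>L\<close>
  times \<open>N\<close>. As \<open>N\<close> may be zero, \<open>L\<close> itself need not
  vanish.\<close>

lemma pencil_equation_iff:
  fixes a b c p q s t k y z :: int
  defines "D \<equiv> a * p\<^sup>2 + b * q\<^sup>2" and "N \<equiv> mat22 0 y z (- k)"
  defines "L \<equiv> 2 * (a * p * s + b * q * t) - k * D"
  shows "a \<cdot>\<^sub>m ((s \<cdot>\<^sub>m 1\<^sub>m 2 + p \<cdot>\<^sub>m N) ^\<^sub>m 2) + b \<cdot>\<^sub>m ((t \<cdot>\<^sub>m 1\<^sub>m 2 + q \<cdot>\<^sub>m N) ^\<^sub>m 2) = c \<cdot>\<^sub>m 1\<^sub>m 2 \<longleftrightarrow>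
    a * s\<^sup>2 + b * t\<^sup>2 + D * (y * z) = c \<and> L * y = 0 \<and> L * z = 0 \<and> L * k = 0"
proof -
  have "a \<cdot>\<^sub>m ((s \<cdot>\<^sub>m 1\<^sub>m 2 + p \<cdot>\<^sub>m N) ^\<^sub>m 2) + b \<cdot>\<^sub>m ((t \<cdot>\<^sub>m 1\<^sub>m 2 + q \<cdot>\<^sub>m N) ^\<^sub>m 2) =
    mat22 (a * s\<^sup>2 + b * t\<^sup>2 + D * (y * z)) (L * y) (L * z)
      (a * s\<^sup>2 + b * t\<^sup>2 + D * (y * z) - L * k)"
    unfolding N_def L_def D_def one_mat22
    by (simp add: algebra_simps power2_eq_square)
  then show ?thesis by (auto simp: one_mat22)
qed

text \<open>Explains the fraction in (iii): \<open>2 * a * c * (c - u)\<close> over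
  \<open>g\<^sup>2\<close> is the integer \<open>D\<close>.\<close>

lemma form_value_times_square:
  fixes a b c p q g u v :: int
  assumes "u - c = p * g" and "v * a = q * g" and "u\<^sup>2 + v\<^sup>2 * a * b = c\<^sup>2"
  shows "(a * p\<^sup>2 + b * q\<^sup>2) * g\<^sup>2 = 2 * a * c * (c - u)"
proof -
  have "(a * p\<^sup>2 + b * q\<^sup>2) * g\<^sup>2 = a * (p * g)\<^sup>2 + b * (q * g)\<^sup>2"
    by (simp add: algebra_simps power2_eq_square)
  also have "\<dots> = a * ((u - c)\<^sup>2 + v\<^sup>2 * a * b)"
    unfolding assms(1,2)[symmetric] by (simp add: algebra_simps power2_eq_square)
  also have "v\<^sup>2 * a * b = c\<^sup>2 - u\<^sup>2" using assms(3) by simp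
  also have "a * ((u - c)\<^sup>2 + (c\<^sup>2 - u\<^sup>2)) = 2 * a * c * (c - u)"
    by (simp add: algebra_simps power2_eq_square)
  finally show ?thesis .
qed

lemma norm_equation_iff:
  fixes a c g u y z D n r :: int
  assumes "D * g\<^sup>2 = 2 * a * c * (c - u)" and "g \<noteq> 0"
  shows "rat_of_int n + rat_of_int (2 * a * c * y * z) / rat_of_int (g\<^sup>2) * rat_of_int (c - u)
      = rat_of_int r \<longleftrightarrow> n + D * (y * z) = r"
proof -
  have "2 * a * c * y * z * (c - u) = D * (y * z) * g\<^sup>2"
    using assms(1) by Groebner_Basis.algebra
  then have "rat_of_int (2 * a * c * y * z) / rat_of_int (g\<^sup>2) * rat_of_int (c - u)
      = rat_of_int (D * (y * z) * g\<^sup>2) / rat_of_int (g\<^sup>2)"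
    by (metis of_int_mult times_divide_eq_left)
  also have "\<dots> = rat_of_int (D * (y * z))"
    using assms(2) by simp
  finally show ?thesis by (simp only: of_int_add[symmetric] of_int_eq_iff)
qed

lemma linear_equation_iff:
  fixes a b c p q g u v s t k :: int
  assumes "u - c = p * g" and "v * a = q * g" and "u\<^sup>2 + v\<^sup>2 * a * b = c\<^sup>2"
    and "a \<noteq> 0" and "g \<noteq> 0"
  shows "(g * s + c * k) * (u - c) + v * b * g * t = 0 \<longleftrightarrow>
    2 * (a * p * s + b * q * t) - k * (a * p\<^sup>2 + b * q\<^sup>2) = 0"
proof -
  \<comment> \<open>After multiplication by \<open>2 * a\<close>, the term with \<open>k\<close>
    contains \<open>2 * a * c * (u - c)\<close>, which is \<open>- D * g\<^sup>2\<close>.\<close>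
  have "2 * a * ((g * s + c * k) * (u - c) + v * b * g * t)
      = g\<^sup>2 * (2 * (a * p * s + b * q * t) - k * (a * p\<^sup>2 + b * q\<^sup>2))"
    using assms(1-3) by Groebner_Basis.algebra
  then show ?thesis using assms(4,5)
    by (metis mult_eq_0_iff power_not_zero zero_neq_numeral)
qed

text \<open>The forced values of \<open>g\<close> and \<open>v\<close> are integers by
  \<open>form_value_divides\<close>, and \<open>u\<close> is \<open>c + p * g\<close>. Coprimality
  of \<open>p\<close> and \<open>q\<close> gives the gcd.\<close>

lemma pencil_parameters_exist:
  fixes a b c p q s t k m :: int
  defines "D \<equiv> a * p\<^sup>2 + b * q\<^sup>2"
  assumes "a \<noteq> 0" "c \<noteq> 0" "p \<noteq> 0" "D \<noteq> 0" and cop: "coprime p q"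
    and norm: "a * s\<^sup>2 + b * t\<^sup>2 + D * m = c"
    and lin: "2 * (a * p * s + b * q * t) = k * D"
  obtains u v g where "g \<noteq> 0" "u - c = p * g" "v * a = q * g" "u\<^sup>2 + v\<^sup>2 * a * b = c\<^sup>2"
    "gcd (v * a) (u - c) = \<bar>g\<bar>"
proof -
  obtain g' where g': "2 * a * c * p = D * g'"
    using form_value_divides(1)[of p q a s b t m c k] cop norm lin unfolding D_def by blast
  obtain v' where v': "2 * c * p * q = D * v'"
    using form_value_divides(2)[of p q a s b t m c k] cop norm lin unfolding D_def by blast
  define g where "g = - g'"
  define v where "v = - v'"
  have g: "2 * a * c * p + D * g = 0" and v: "2 * c * p * q + D * v = 0"
    using g' v' by (simp_all add: g_def v_def)
  have "D * (v * a) = D * (q * g)" using g v by Groebner_Basis.algebra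
  then have va: "v * a = q * g" using \<open>D \<noteq> 0\<close> by simp
  \<comment> \<open>By \<open>v * a = q * g\<close> the left side is
    \<open>g * (2 * a * c * p + D * g)\<close>.\<close>
  have "a * ((c + p * g)\<^sup>2 + v\<^sup>2 * a * b - c\<^sup>2) = 0"
    using va g unfolding D_def by Groebner_Basis.algebra
  then have norm': "(c + p * g)\<^sup>2 + v\<^sup>2 * a * b = c\<^sup>2" using \<open>a \<noteq> 0\<close> by simp
  have "gcd (q * g) (p * g) = \<bar>g\<bar>"
    using cop by (simp add: gcd_mult_right coprime_iff_gcd_eq_1 gcd.commute)
  then have "gcd (v * a) (c + p * g - c) = \<bar>g\<bar>" by (simp add: va)
  moreover have "g \<noteq> 0" using g assms by auto
  ultimately show thesis using that[of g "c + p * g" v] va norm' by simp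
qed

theorem theorem4p1:
  fixes a b c :: int and X Y :: "int mat"
  assumes "a \<noteq> 0" and "b \<noteq> 0" and "c \<noteq> 0"
    and "\<not> is_square (- a * b)"
    and "gcd a (gcd b c) = 1"
    and "X \<in> carrier_mat 2 2" and "Y \<in> carrier_mat 2 2"
  shows "(a \<cdot>\<^sub>m (X ^\<^sub>m 2) + b \<cdot>\<^sub>m (Y ^\<^sub>m 2) = c \<cdot>\<^sub>m 1\<^sub>m 2 \<and> X * Y = Y * X) \<longleftrightarrow>
    (\<exists>t1 t2 :: int.
        X = t1 \<cdot>\<^sub>m 1\<^sub>m 2 \<and> Y = t2 \<cdot>\<^sub>m 1\<^sub>m 2 \<and> a * t1\<^sup>2 + b * t2\<^sup>2 = c)
    \<or>
    (\<exists>t1 t2 t3 t4 :: int.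
        X = t1 \<cdot>\<^sub>m 1\<^sub>m 2 \<and>
        Y = mat_of_rows_list 2 [[t4, t2], [t3, - t4]] \<and>
        a * t1\<^sup>2 + b * (t4\<^sup>2 + t2 * t3) = c)
    \<or>
    (\<exists>t1 t2 t3 t4 u v k g :: int.
        u \<noteq> c \<and> g = gcd (v * a) (u - c) \<and>
        X = t1 \<cdot>\<^sub>m 1\<^sub>m 2 + ((u - c) div g) \<cdot>\<^sub>m mat_of_rows_list 2 [[0, t2], [t3, - k]] \<and>
        Y = t4 \<cdot>\<^sub>m 1\<^sub>m 2 + ((v * a) div g) \<cdot>\<^sub>m mat_of_rows_list 2 [[0, t2], [t3, - k]] \<and>
        u\<^sup>2 + v\<^sup>2 * a * b = c\<^sup>2 \<and>
        rat_of_int (a * t1\<^sup>2 + b * t4\<^sup>2)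
          + rat_of_int (2 * a * c * t2 * t3) / rat_of_int (g\<^sup>2) * rat_of_int (c - u)
          = rat_of_int c \<and>
        (g * t1 + c * k) * (u - c) + v * b * g * t4 = 0)"
proof -
  define N where "N y z k = mat22 0 y z (- k)" for y z k :: int
  have N_eq: "mat_of_rows_list 2 [[0, y], [z, - k]] = N y z k" for y z k
    by (simp add: N_def mat22_def)
  obtain x1 x2 x3 x4 where X: "X = mat22 x1 x2 x3 x4" using assms(6) by (rule mat22_cases)
  obtain y1 y2 y3 y4 where Y: "Y = mat22 y1 y2 y3 y4" using assms(7) by (rule mat22_cases)
  show ?thesis (is "?eq \<and> ?comm \<longleftrightarrow> ?i \<or> ?ii \<or> ?iii")
  proof (intro iffI)
    assume asm: "?eq \<and> ?comm"
    show "?i \<or> ?ii \<or> ?iii"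
    proof (cases "x2 = 0 \<and> x3 = 0 \<and> x4 = x1")
      case True
      \<comment> \<open>For scalar \<open>X\<close> the equation only asks that the square of
        \<open>Y\<close> be a suitable scalar matrix, so \<open>Y\<close> is trace-free or
        scalar.\<close>
      have E: "a * x1\<^sup>2 + b * (y1\<^sup>2 + y2 * y3) = c" "b * (y2 * (y1 + y4)) = 0"
        "b * (y3 * (y1 + y4)) = 0" "a * x1\<^sup>2 + b * (y4\<^sup>2 + y2 * y3) = c"
        using asm True by (simp_all add: X Y one_mat22 algebra_simps power2_eq_square)
      have "b * ((y1 - y4) * (y1 + y4)) = 0"
        using arg_cong2[OF E(1) E(4), of "(-)"] by (simp add: algebra_simps power2_eq_square)
      then consider "y4 = - y1" | "y2 = 0" "y3 = 0" "y4 = y1"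
        using E(2,3) \<open>b \<noteq> 0\<close> by force
      then show ?thesis
      proof cases
        case 1
        have ?ii using True 1 E(1)
          by (intro exI[of _ x1] exI[of _ y2] exI[of _ y3] exI[of _ y1])
            (simp add: X Y one_mat22 flip: mat22_def)
        then show ?thesis by blast
      next
        case 2
        have ?i using True 2 E(1)
          by (intro exI[of _ x1] exI[of _ y1]) (simp add: X Y one_mat22)
        then show ?thesis by blast
      qed
    next
      case False
      \<comment> \<open>Coordinates of the trace-free parts; every index from 2 on returns the third
        one, so that \<open>par\<close> holds for all naturals.\<close>
      define f where "f i = (if i = 0 then x2 else if i = 1 then x3 else x4 - x1)" for i :: nat
      define h where "h i = (if i = 0 then y2 else if i = 1 then y3 else y4 - y1)" for i :: nat
      have par: "f i * h j = f j * h i" for i j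
        using asm unfolding X Y mat22_commute_iff by (auto simp: f_def h_def)
      from False have "f 0 \<noteq> 0 \<or> f 1 \<noteq> 0 \<or> f 2 \<noteq> 0" by (auto simp: f_def)
      then obtain i\<^sub>0 where i0: "f i\<^sub>0 \<noteq> 0" by blast
      obtain p q w where cop: "coprime p q" and p0: "p \<noteq> 0"
        and fw: "\<And>i. f i = p * w i" and hw: "\<And>i. h i = q * w i"
        using parallel_int_families[of f h, OF par i0] by blast
      \<comment> \<open>The lower right entry of \<open>N\<close> is \<open>- k\<close>, hence the
        sign.\<close>
      define y z k where "y = w 0" and "z = w 1" and "k = - w 2"
      have XN: "X = x1 \<cdot>\<^sub>m 1\<^sub>m 2 + p \<cdot>\<^sub>m N y z k"
        using fw[of 0] fw[of 1] fw[of 2]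
        by (simp add: X N_def one_mat22 f_def y_def z_def k_def)
      have YN: "Y = y1 \<cdot>\<^sub>m 1\<^sub>m 2 + q \<cdot>\<^sub>m N y z k"
        using hw[of 0] hw[of 1] hw[of 2]
        by (simp add: Y N_def one_mat22 h_def y_def z_def k_def)
      define D where "D = a * p\<^sup>2 + b * q\<^sup>2"
      have D0: "D \<noteq> 0" using binary_form_nonzero assms(4) p0 unfolding D_def by blast
      define L where "L = 2 * (a * p * x1 + b * q * y1) - k * D"
      have E: "a * x1\<^sup>2 + b * y1\<^sup>2 + D * (y * z) = c" "L * y = 0" "L * z = 0" "L * k = 0"
        using asm unfolding XN YN N_def pencil_equation_iff L_def D_def by blast+
      \<comment> \<open>\<open>X\<close> is not scalar, so \<open>N\<close> is nonzero and
        \<open>L\<close> must vanish.\<close>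
      have "y \<noteq> 0 \<or> z \<noteq> 0 \<or> k \<noteq> 0"
        using False fw[of 0] fw[of 1] fw[of 2] by (auto simp: f_def y_def z_def k_def)
      then have L0: "L = 0" using E by auto
      then have lin: "2 * (a * p * x1 + b * q * y1) = k * D" by (simp add: L_def)
      obtain u v g where par: "g \<noteq> 0" "u - c = p * g" "v * a = q * g"
          "u\<^sup>2 + v\<^sup>2 * a * b = c\<^sup>2" "gcd (v * a) (u - c) = \<bar>g\<bar>"
        using pencil_parameters_exist[of a c p b q x1 y1 "y * z" k] assms(1,3) p0 cop E(1) lin D0
        unfolding D_def by blast
      \<comment> \<open>The gcd is positive, so the sign of \<open>g\<close> is moved into \<open>N\<close>.\<close>
      define \<sigma> where "\<sigma> = sgn g"
      have \<sigma>: "\<sigma> * \<sigma> = 1" "\<bar>g\<bar> = \<sigma> * g" using \<open>g \<noteq> 0\<close> by (auto simp: \<sigma>_def sgn_if abs_if)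
      have uc: "u - c = (\<sigma> * p) * \<bar>g\<bar>" and va: "v * a = (\<sigma> * q) * \<bar>g\<bar>"
        using par(2,3) \<sigma> by Groebner_Basis.algebra+
      have sN: "(\<sigma> * r) \<cdot>\<^sub>m N (\<sigma> * y) (\<sigma> * z) (\<sigma> * k) = r \<cdot>\<^sub>m N y z k" for r
      proof -
        have "\<sigma> * r * (\<sigma> * j) = r * j" for j using \<sigma>(1) by Groebner_Basis.algebra
        then show ?thesis by (simp add: N_def)
      qed
      have D\<sigma>: "a * (\<sigma> * p)\<^sup>2 + b * (\<sigma> * q)\<^sup>2 = D"
        using \<sigma>(1) unfolding D_def by Groebner_Basis.algebra
      have yz: "(\<sigma> * y) * (\<sigma> * z) = y * z"
        using \<sigma>(1) by Groebner_Basis.algebra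
      have "a * x1\<^sup>2 + b * y1\<^sup>2 + D * ((\<sigma> * y) * (\<sigma> * z)) = c"
        unfolding yz by (rule E(1))
      then have norm: "rat_of_int (a * x1\<^sup>2 + b * y1\<^sup>2)
          + rat_of_int (2 * a * c * (\<sigma> * y) * (\<sigma> * z)) / rat_of_int (\<bar>g\<bar>\<^sup>2) * rat_of_int (c - u)
          = rat_of_int c"
        using norm_equation_iff form_value_times_square[OF uc va par(4)] \<open>g \<noteq> 0\<close>
        by (simp only: D\<sigma> abs_eq_0 simp_thms)
      have "2 * (a * (\<sigma> * p) * x1 + b * (\<sigma> * q) * y1)
          - (\<sigma> * k) * (a * (\<sigma> * p)\<^sup>2 + b * (\<sigma> * q)\<^sup>2) = 0"
        unfolding D\<sigma> using lin by Groebner_Basis.algebra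
      then have "(\<bar>g\<bar> * x1 + c * (\<sigma> * k)) * (u - c) + v * b * \<bar>g\<bar> * y1 = 0"
        using linear_equation_iff[OF uc va par(4) assms(1)] \<open>g \<noteq> 0\<close> by simp
      moreover have "u \<noteq> c" using par(1,2) p0 by auto
      moreover have "X = x1 \<cdot>\<^sub>m 1\<^sub>m 2 + ((u - c) div \<bar>g\<bar>) \<cdot>\<^sub>m N (\<sigma> * y) (\<sigma> * z) (\<sigma> * k)"
        unfolding uc using \<open>g \<noteq> 0\<close> XN sN by simp
      moreover have "Y = y1 \<cdot>\<^sub>m 1\<^sub>m 2 + ((v * a) div \<bar>g\<bar>) \<cdot>\<^sub>m N (\<sigma> * y) (\<sigma> * z) (\<sigma> * k)"
        unfolding va using \<open>g \<noteq> 0\<close> YN sN by simp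
      ultimately have ?iii using norm par(4) par(5)[symmetric] unfolding N_eq by blast
      then show ?thesis by blast
    qed
  next
    assume "?i \<or> ?ii \<or> ?iii"
    then consider ?i | ?ii | ?iii by blast
    then show "?eq \<and> ?comm"
    proof cases
      case 1
      then show ?thesis
        by (auto simp: one_mat22 algebra_simps power2_eq_square)
    next
      case 2
      then show ?thesis
        unfolding mat22_def[symmetric] by (auto simp: one_mat22 algebra_simps power2_eq_square)
    next
      case 3
      then obtain t1 y z t4 u v k g where uc: "u \<noteq> c" and g: "g = gcd (v * a) (u - c)"
        and XN: "X = t1 \<cdot>\<^sub>m 1\<^sub>m 2 + ((u - c) div g) \<cdot>\<^sub>m N y z k"
        and YN: "Y = t4 \<cdot>\<^sub>m 1\<^sub>m 2 + ((v * a) div g) \<cdot>\<^sub>m N y z k"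
        and uv: "u\<^sup>2 + v\<^sup>2 * a * b = c\<^sup>2"
        and norm: "rat_of_int (a * t1\<^sup>2 + b * t4\<^sup>2)
          + rat_of_int (2 * a * c * y * z) / rat_of_int (g\<^sup>2) * rat_of_int (c - u)
          = rat_of_int c"
        and lin: "(g * t1 + c * k) * (u - c) + v * b * g * t4 = 0"
        unfolding N_eq by blast
      define p q where "p = (u - c) div g" and "q = (v * a) div g"
      \<comment> \<open>Both divisions are exact because \<open>g\<close> is the gcd.\<close>
      have pq: "u - c = p * g" "v * a = q * g" by (simp_all add: p_def q_def g)
      have g0: "g \<noteq> 0" using g uc by simp
      have ?eq
        using norm lin
        unfolding XN YN p_def[symmetric] q_def[symmetric] N_def pencil_equation_iff
          norm_equation_iff[OF form_value_times_square[OF pq uv] g0]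
          linear_equation_iff[OF pq uv assms(1) g0] by simp
      \<comment> \<open>Both matrices are polynomials in the same \<open>N\<close>.\<close>
      moreover have ?comm
        unfolding XN YN N_def one_mat22 by (simp add: algebra_simps)
      ultimately show ?thesis by blast
    qed
  qed
qed

end
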